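(* Let $M=(S,P,I,AP,L)$ be a finite possibilistic Kripke structure, let $B\subseteq S$ and let $s\in S$. Then $$Po(s\models\square\lozenge B)=\bigvee_{a\in B}\big(P^+(s,a)\wedge P^+(a,a)\big).$$
   Context: For subsets or families in $[0,1]$, $\vee$ denotes supremum and $\wedge$ infimum (with $\bigvee\emptyset=0$). A possibilistic Kripke structure is a tuple $M=(S,P,I,AP,L)$ where $S$ is a countable nonempty set of states; $P:S\times S\to[0,1]$ satisfies $\bigvee_{s'\in S}P(s,s')=1$ for all $s\in S$; $I:S\to[0,1]$ satisfies $\bigvee_{s\in S}I(s)=1$; $AP$ is a set of atomic propositions; and $L:S\to 2^{AP}$ is a labeling function. It is finite if $S$ and $AP$ are finite. A path of $M$ is an infinite sequence $\pi=s_0s_1s_2\cdots\in S^\omega$ with $P(s_i,s_{i+1})>0$ for all $i\ge 0$; $Paths(M)$ is the set of all paths and $Paths(s)$ the set of those with $s_0=s$. Define $Po^M(\pi)=I(s_0)\wedge\bigwedge_{i=0}^\infty P(s_i,s_{i+1})$ for $\pi=s_0s_1\cdots\in Paths(M)$, and $Po^M(E)=\bigvee\{Po^M(\pi)\mid\pi\in E\}$ for $E\subseteq Paths(M)$. For a state $s$, $M_s$ is the structure obtained from $M$ by replacing $I$ with the initial distribution that is $1$ at $s$ and $0$ elsewhere. For a set of paths $E$, $Po(s\models E)=Po^{M_s}(E\cap Paths(s))$. The event $\square\lozenge B$ is the set of all paths that visit $B$ infinitely often. The transitive closure $P^+$ of $P$ is $P^+(s,t)=\bigvee\{P(s_0,s_1)\wedge\cdots\wedge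 P(s_{k-1},s_k)\mid k\ge1,\ s_0=s,\ s_k=t,\ s_1,\dots,s_{k-1}\in S\}$. *)

theory Defs
  imports Complex_Main "HOL-Library.Countable_Set"
begin

text \<open>Suprema are taken in the lattice [0,1], hence the supremum of the empty family is 0;
  the library leaves the supremum of the empty set of reals unspecified.\<close>

definition psup :: "real set \<Rightarrow> real" where
  "psup A = (if A = {} then 0 else Sup A)"

text \<open>The transition and initial functions are total on the type of states; only their values on
  the carrier \<open>states M\<close> are meaningful.\<close>

record ('s, 'ap) pks =
  states :: "'s set"
  poss :: "'s \<Rightarrow> 's \<Rightarrow> real"
  init :: "'s \<Rightarrow> real"
  props :: "'ap set"
  label :: "'s \<Rightarrow> 'ap set"

definition possibilistic_kripke :: "('s, 'ap) pks \<Rightarrow> bool" where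
  "possibilistic_kripke M \<longleftrightarrow>
     countable (states M) \<and> states M \<noteq> {} \<and>
     (\<forall>s\<in>states M. \<forall>t\<in>states M. 0 \<le> poss M s t \<and> poss M s t \<le> 1) \<and>
     (\<forall>s\<in>states M. psup (poss M s ` states M) = 1) \<and>
     (\<forall>s\<in>states M. 0 \<le> init M s \<and> init M s \<le> 1) \<and>
     psup (init M ` states M) = 1 \<and>
     (\<forall>s\<in>states M. label M s \<subseteq> props M)"

definition finite_possibilistic_kripke :: "('s, 'ap) pks \<Rightarrow> bool" where
  "finite_possibilistic_kripke M \<longleftrightarrow>
     possibilistic_kripke M \<and> finite (states M) \<and> finite (props M)"

definition Paths :: "('s, 'ap) pks \<Rightarrow> (nat \<Rightarrow> 's) set" where
  "Paths M = {\<pi>. \<forall>i. \<pi> i \<in> states M \<and> poss M (\<pi> i) (\<pi> (Suc i)) > 0}"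

definition Paths_from :: "('s, 'ap) pks \<Rightarrow> 's \<Rightarrow> (nat \<Rightarrow> 's) set" where
  "Paths_from M s = {\<pi> \<in> Paths M. \<pi> 0 = s}"

definition Po_path :: "('s, 'ap) pks \<Rightarrow> (nat \<Rightarrow> 's) \<Rightarrow> real" where
  "Po_path M \<pi> = min (init M (\<pi> 0)) (INF i. poss M (\<pi> i) (\<pi> (Suc i)))"

definition Po :: "('s, 'ap) pks \<Rightarrow> (nat \<Rightarrow> 's) set \<Rightarrow> real" where
  "Po M E = psup (Po_path M ` E)"

definition start_at :: "('s, 'ap) pks \<Rightarrow> 's \<Rightarrow> ('s, 'ap) pks" where
  "start_at M s = M\<lparr>init := (\<lambda>t. if t = s then 1 else 0)\<rparr>"

definition Po_sat :: "('s, 'ap) pks \<Rightarrow> 's \<Rightarrow> (nat \<Rightarrow> 's) set \<Rightarrow> real" where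
  "Po_sat M s E = Po (start_at M s) (E \<inter> Paths_from M s)"

definition always_eventually :: "('s, 'ap) pks \<Rightarrow> 's set \<Rightarrow> (nat \<Rightarrow> 's) set" where
  "always_eventually M B = {\<pi> \<in> Paths M. \<exists>\<^sub>\<infinity>i. \<pi> i \<in> B}"

definition poss_plus :: "('s, 'ap) pks \<Rightarrow> 's \<Rightarrow> 's \<Rightarrow> real" where
  "poss_plus M s t =
     psup {Min ((\<lambda>i. poss M (w i) (w (Suc i))) ` {..<k}) | w k.
             k \<ge> 1 \<and> w 0 = s \<and> w k = t \<and> (\<forall>i. 0 < i \<and> i < k \<longrightarrow> w i \<in> states M)}"

end

(*
  Since the structure is finite, every supremum involved is attained, so it suffices to show that
  both sides exceed the same thresholds r > 0. Fix r and keep only the transitions of possibility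
  at least r. In the resulting finite digraph, an infinite walk from s meets B infinitely often iff
  it can be replaced by a lasso: a nonempty walk from s to some a in B followed by a cycle at a.
*)
theory Submission
  imports Defs
begin

section \<open>Finite suprema and comparison by thresholds\<close>

text \<open>A nonempty finite set attains its supremum. For the empty set both sides fail, since
  \<open>psup {} = 0 < r\<close>.\<close>

lemma le_psup_iff:
  fixes A :: "real set"
  assumes "finite A" "0 < r"
  shows "r \<le> psup A \<longleftrightarrow> (\<exists>x\<in>A. r \<le> x)"
  using assms by (cases "A = {}") (auto simp: psup_def cSup_eq_Max Max_ge_iff)

lemma psup_nonneg:
  fixes A :: "real set"
  assumes "finite A" "\<And>x. x \<in> A \<Longrightarrow> 0 \<le> x"
  shows "0 \<le> psup A"
  using assms by (cases "A = {}") (auto simp: psup_def cSup_eq_Max Max_ge_iff)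

text \<open>Each of \<open>x\<close> and \<open>y\<close> serves as a threshold for the other; one
  that is 0 lies below the other by nonnegativity.\<close>

lemma eq_by_positive_thresholds:
  fixes x y :: real
  assumes "0 \<le> x" "0 \<le> y" "\<And>r. 0 < r \<Longrightarrow> r \<le> x \<longleftrightarrow> r \<le> y"
  shows "x = y"
  using assms(1,2) assms(3)[of x] assms(3)[of y] by linarith

section \<open>Infinite walks and lassos in a digraph\<close>

lemma trancl_fun_conv:
  "(a, b) \<in> R\<^sup>+ \<longleftrightarrow> (\<exists>f n. 0 < n \<and> f 0 = a \<and> f n = b \<and> (\<forall>i<n. (f i, f (Suc i)) \<in> R))"
  unfolding trancl_power relpow_fun_conv by blast

lemma chain_imp_trancl:
  assumes "\<And>i. (f i, f (Suc i)) \<in> R" "i < j"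
  shows "(f i, f j) \<in> R\<^sup>+"
  using assms(2)
proof (induction j)
  case (Suc j)
  then show ?case
    using assms(1)[of j] by (cases "i = j") (auto intro: trancl_into_trancl)
qed simp

text \<open>Follow a walk \<open>v\<close> of length \<open>m\<close> from \<open>s\<close> to
  \<open>a\<close> once, then run around a cycle \<open>w\<close> of length \<open>k\<close> at
  \<open>a\<close> forever.\<close>

lemma lasso_chain:
  assumes "(s, a) \<in> R\<^sup>+" "(a, a) \<in> R\<^sup>+"
  obtains f where "f 0 = s" "\<And>i. (f i, f (Suc i)) \<in> R" "\<exists>\<^sub>\<infinity>i. f i = a"
proof -
  obtain v m where v: "v 0 = s" "v m = a" "\<And>i. i < m \<Longrightarrow> (v i, v (Suc i)) \<in> R"
    using assms(1) unfolding trancl_fun_conv by blast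
  obtain w k where k: "0 < k" and w: "w 0 = a" "w k = a" "\<And>i. i < k \<Longrightarrow> (w i, w (Suc i)) \<in> R"
    using assms(2) unfolding trancl_fun_conv by blast
  define f where "f i = (if i < m then v i else w ((i - m) mod k))" for i
  have "f 0 = s"
    using v(1,2) w(1) by (auto simp: f_def)
  moreover have "(f i, f (Suc i)) \<in> R" for i
  proof (cases "i < m")
    case True
    \<comment> \<open>At the junction \<open>Suc i = m\<close> the definition already switches to
      \<open>w 0\<close>, which equals \<open>a = v m\<close>.\<close>
    then have "f (Suc i) = v (Suc i)"
      using v(2) w(1) by (cases "Suc i = m") (auto simp: f_def)
    with True v(3) show ?thesis by (simp add: f_def)
  next
    case False
    \<comment> \<open>When the residue wraps around from \<open>k - 1\<close> to 0, the equality
      \<open>w k = w 0\<close> keeps this formula valid.\<close>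
    then have "f (Suc i) = w (Suc ((i - m) mod k))"
      using w(1,2) by (simp add: f_def Suc_diff_le mod_Suc)
    with False w(3)[of "(i - m) mod k"] k show ?thesis by (simp add: f_def)
  qed
  moreover have "\<exists>\<^sub>\<infinity>i. f i = a"
    unfolding INFM_nat_le
  proof
    fix n
    \<comment> \<open>The \<open>n\<close>-th return to the start of the cycle happens at time
      \<open>m + n * k\<close>, which is at least \<open>n\<close> because \<open>k\<close> is
      positive.\<close>
    have "n \<le> m + n * k" using k by (cases k) auto
    moreover have "f (m + n * k) = a" using w(1) by (simp add: f_def)
    ultimately show "\<exists>i\<ge>n. f i = a" by blast
  qed
  ultimately show ?thesis by (rule that)
qed

text \<open>Pigeonhole: as \<open>B\<close> is finite, some single \<open>a\<close> in
  \<open>B\<close> is visited infinitely often. The converse unrolls the lasso.\<close>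

lemma infinitely_often_iff_lasso:
  assumes "finite B"
  shows "(\<exists>f. f 0 = s \<and> (\<forall>i. (f i, f (Suc i)) \<in> R) \<and> (\<exists>\<^sub>\<infinity>i. f i \<in> B))
    \<longleftrightarrow> (\<exists>a\<in>B. (s, a) \<in> R\<^sup>+ \<and> (a, a) \<in> R\<^sup>+)"
proof
  assume "\<exists>f. f 0 = s \<and> (\<forall>i. (f i, f (Suc i)) \<in> R) \<and> (\<exists>\<^sub>\<infinity>i. f i \<in> B)"
  then obtain f where f: "f 0 = s" "\<And>i. (f i, f (Suc i)) \<in> R" "\<exists>\<^sub>\<infinity>i. \<exists>a\<in>B. a = f i"
    by auto
  then obtain a where a: "a \<in> B" "\<exists>\<^sub>\<infinity>i. a = f i"
    unfolding INFM_finite_Bex_distrib[OF assms] by blast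
  \<comment> \<open>A visit at a positive time makes the walk from \<open>s\<close> nonempty, even
    if \<open>s = a\<close>; a strictly later visit then closes a cycle at \<open>a\<close>.\<close>
  then obtain i where "0 < i" "a = f i"
    unfolding INFM_nat by blast
  moreover from a obtain j where "i < j" "a = f j"
    unfolding INFM_nat by blast
  ultimately have "(f 0, a) \<in> R\<^sup>+" "(a, a) \<in> R\<^sup>+"
    using chain_imp_trancl[of f R, OF f(2)] by metis+
  with f(1) a(1) show "\<exists>a\<in>B. (s, a) \<in> R\<^sup>+ \<and> (a, a) \<in> R\<^sup>+" by blast
next
  assume "\<exists>a\<in>B. (s, a) \<in> R\<^sup>+ \<and> (a, a) \<in> R\<^sup>+"
  then obtain a where a: "a \<in> B" "(s, a) \<in> R\<^sup>+" "(a, a) \<in> R\<^sup>+" by blast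
  obtain f where "f 0 = s" "\<And>i. (f i, f (Suc i)) \<in> R" "\<exists>\<^sub>\<infinity>i. f i = a"
    using lasso_chain[OF a(2,3)] by blast
  moreover from this(3) have "\<exists>\<^sub>\<infinity>i. f i \<in> B"
    by (rule INFM_mono) (simp add: a(1))
  ultimately show "\<exists>f. f 0 = s \<and> (\<forall>i. (f i, f (Suc i)) \<in> R) \<and> (\<exists>\<^sub>\<infinity>i. f i \<in> B)"
    by blast
qed

section \<open>Threshold digraphs and the transitive closure of the transition function\<close>

text \<open>Membership in the carrier is built in, so walks in this relation never leave
  \<open>states M\<close>.\<close>

definition poss_cut :: "('s, 'ap) pks \<Rightarrow> real \<Rightarrow> ('s \<times> 's) set" where
  "poss_cut M r = {(x, y). x \<in> states M \<and> y \<in> states M \<and> r \<le> poss M x y}"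

text \<open>A finite subset of [0,1] that will contain the value of every walk and path. Infinite
  families of walks or paths thus still have finitely many values, and their suprema are
  attained.\<close>

definition poss_values :: "('s, 'ap) pks \<Rightarrow> real set" where
  "poss_values M = (\<lambda>(x, y). poss M x y) ` (states M \<times> states M)"

lemma poss_in_poss_values:
  "x \<in> states M \<Longrightarrow> y \<in> states M \<Longrightarrow> poss M x y \<in> poss_values M"
  by (force simp: poss_values_def)

lemma finite_poss_values:
  "finite_possibilistic_kripke M \<Longrightarrow> finite (poss_values M)"
  by (simp add: poss_values_def finite_possibilistic_kripke_def)

lemma poss_values_range:
  assumes "finite_possibilistic_kripke M" "x \<in> poss_values M"
  shows "0 \<le> x \<and> x \<le> 1"
  using assms
  by (auto simp: poss_values_def finite_possibilistic_kripke_def possibilistic_kripke_def)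

text \<open>Names the family inside \<open>poss_plus\<close>, so that it can be folded after
  unfolding \<open>poss_plus_def\<close>.\<close>

definition walk_values :: "('s, 'ap) pks \<Rightarrow> 's \<Rightarrow> 's \<Rightarrow> real set" where
  "walk_values M s t = {Min ((\<lambda>i. poss M (w i) (w (Suc i))) ` {..<k}) | w k.
     k \<ge> 1 \<and> w 0 = s \<and> w k = t \<and> (\<forall>i. 0 < i \<and> i < k \<longrightarrow> w i \<in> states M)}"

lemma walk_in_states:
  fixes w :: "nat \<Rightarrow> 's"
  assumes "w 0 = s" "w k = t" "\<forall>i. 0 < i \<and> i < k \<longrightarrow> w i \<in> states M"
    and "s \<in> states M" "t \<in> states M" "i \<le> k"
  shows "w i \<in> states M"
  using assms by (cases "i = 0"; cases "i = k") auto

text \<open>The minimum over a nonempty finite set of steps is the possibility of one of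
  them.\<close>

lemma walk_values_subset:
  assumes "s \<in> states M" "t \<in> states M"
  shows "walk_values M s t \<subseteq> poss_values M"
proof
  fix x assume "x \<in> walk_values M s t"
  then obtain w k where k: "k \<ge> 1"
    and w: "w 0 = s" "w k = t" "\<forall>i. 0 < i \<and> i < k \<longrightarrow> w i \<in> states M"
    and x: "x = Min ((\<lambda>i. poss M (w i) (w (Suc i))) ` {..<k})"
    unfolding walk_values_def by blast
  have "x \<in> (\<lambda>i. poss M (w i) (w (Suc i))) ` {..<k}"
    unfolding x using k by (intro Min_in) (auto simp: lessThan_empty_iff)
  then show "x \<in> poss_values M"
    by (auto intro!: poss_in_poss_values walk_in_states[OF w assms])
qed

lemma poss_plus_nonneg:
  assumes M: "finite_possibilistic_kripke M" and "s \<in> states M" "t \<in> states M"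
  shows "0 \<le> poss_plus M s t"
  unfolding poss_plus_def walk_values_def[symmetric]
  using walk_values_subset[OF assms(2,3)] poss_values_range[OF M] finite_poss_values[OF M]
  by (intro psup_nonneg) (auto intro: finite_subset)

text \<open>Since the supremum is attained, the threshold is reached by a single walk, and its
  minimum is at least \<open>r\<close> exactly when every step is.\<close>

lemma le_poss_plus_iff:
  assumes M: "finite_possibilistic_kripke M" and st: "s \<in> states M" "t \<in> states M" and "0 < r"
  shows "r \<le> poss_plus M s t \<longleftrightarrow> (s, t) \<in> (poss_cut M r)\<^sup>+"
proof -
  have "r \<le> poss_plus M s t \<longleftrightarrow> (\<exists>x\<in>walk_values M s t. r \<le> x)"
    unfolding poss_plus_def walk_values_def[symmetric]
    using walk_values_subset[OF st] finite_poss_values[OF M] \<open>0 < r\<close>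
    by (intro le_psup_iff) (auto intro: finite_subset)
  also have "\<dots> \<longleftrightarrow> (\<exists>w k. k \<ge> 1 \<and> w 0 = s \<and> w k = t \<and>
      (\<forall>i. 0 < i \<and> i < k \<longrightarrow> w i \<in> states M) \<and>
      r \<le> Min ((\<lambda>i. poss M (w i) (w (Suc i))) ` {..<k}))"
    unfolding walk_values_def by blast
  also have "\<dots> \<longleftrightarrow> (\<exists>w k. 0 < k \<and> w 0 = s \<and> w k = t \<and>
      (\<forall>i<k. (w i, w (Suc i)) \<in> poss_cut M r))"
  proof (intro ex_cong1)
    fix w k
    have "(\<forall>i. 0 < i \<and> i < k \<longrightarrow> w i \<in> states M) \<and>
        r \<le> Min ((\<lambda>i. poss M (w i) (w (Suc i))) ` {..<k}) \<longleftrightarrow>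
        (\<forall>i<k. (w i, w (Suc i)) \<in> poss_cut M r)"
      if k: "0 < k" and w: "w 0 = s" "w k = t"
    proof -
      have "r \<le> Min ((\<lambda>i. poss M (w i) (w (Suc i))) ` {..<k}) \<longleftrightarrow>
          (\<forall>i<k. r \<le> poss M (w i) (w (Suc i)))"
        using k by (subst Min_ge_iff) (auto simp: lessThan_empty_iff)
      \<comment> \<open>The definition of \<open>poss_plus\<close> constrains only interior points,
        while \<open>poss_cut\<close> needs both ends of each step in the carrier; the end points
        are covered by the assumptions on \<open>s\<close> and \<open>t\<close>.\<close>
      then show ?thesis
        using walk_in_states[of w s k t M] w st by (auto simp: poss_cut_def)
    qed
    then show "(k \<ge> 1 \<and> w 0 = s \<and> w k = t \<and>
        (\<forall>i. 0 < i \<and> i < k \<longrightarrow> w i \<in> states M) \<and>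
        r \<le> Min ((\<lambda>i. poss M (w i) (w (Suc i))) ` {..<k})) \<longleftrightarrow>
        (0 < k \<and> w 0 = s \<and> w k = t \<and> (\<forall>i<k. (w i, w (Suc i)) \<in> poss_cut M r))"
      by (auto simp: Suc_le_eq)
  qed
  also have "\<dots> \<longleftrightarrow> (s, t) \<in> (poss_cut M r)\<^sup>+"
    by (rule trancl_fun_conv[symmetric])
  finally show ?thesis .
qed

section \<open>Possibility of paths and of events\<close>

lemma path_steps_subset:
  "\<pi> \<in> Paths M \<Longrightarrow> range (\<lambda>i. poss M (\<pi> i) (\<pi> (Suc i))) \<subseteq> poss_values M"
  by (auto simp: Paths_def intro!: poss_in_poss_values)

text \<open>The steps of a path take finitely many values, so the infimum is a minimum.\<close>

lemma path_inf_in_poss_values: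
  assumes "finite_possibilistic_kripke M" "\<pi> \<in> Paths M"
  shows "(INF i. poss M (\<pi> i) (\<pi> (Suc i))) \<in> poss_values M"
proof -
  have "finite (range (\<lambda>i. poss M (\<pi> i) (\<pi> (Suc i))))"
    using finite_subset[OF path_steps_subset finite_poss_values] assms by blast
  then have "(INF i. poss M (\<pi> i) (\<pi> (Suc i))) \<in> range (\<lambda>i. poss M (\<pi> i) (\<pi> (Suc i)))"
    by (subst cInf_eq_Min) (auto intro: Min_in)
  then show ?thesis
    using path_steps_subset[OF assms(2)] by blast
qed

text \<open>The initial possibility is 1 at \<open>s\<close>, and the infimum is at most 1, so the
  outer minimum drops out.\<close>

lemma Po_path_start_at:
  assumes "finite_possibilistic_kripke M" "\<pi> \<in> Paths_from M s"
  shows "Po_path (start_at M s) \<pi> = (INF i. poss M (\<pi> i) (\<pi> (Suc i)))"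
  using assms poss_values_range[OF assms(1) path_inf_in_poss_values[OF assms(1)], of \<pi>]
  by (auto simp: Po_path_def start_at_def Paths_from_def min_def)

lemma le_Po_path_start_at_iff:
  assumes M: "finite_possibilistic_kripke M" and \<pi>: "\<pi> \<in> Paths_from M s"
  shows "r \<le> Po_path (start_at M s) \<pi> \<longleftrightarrow> (\<forall>i. (\<pi> i, \<pi> (Suc i)) \<in> poss_cut M r)"
proof -
  \<comment> \<open>The reals are only conditionally complete, so the infimum is characterised by
    its lower bounds only for families bounded below.\<close>
  have "bdd_below (range (\<lambda>i. poss M (\<pi> i) (\<pi> (Suc i))))"
    using path_steps_subset[of \<pi> M] finite_poss_values[OF M] \<pi>
    by (auto simp: Paths_from_def intro: bdd_below_mono bdd_below_finite)
  then have "r \<le> (INF i. poss M (\<pi> i) (\<pi> (Suc i))) \<longleftrightarrow> (\<forall>i. r \<le> poss M (\<pi> i) (\<pi> (Suc i)))"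
    by (subst le_cINF_iff) auto
  then show ?thesis
    using \<pi> by (auto simp: Po_path_start_at[OF assms] poss_cut_def Paths_from_def Paths_def)
qed

lemma Po_path_start_at_values:
  assumes "finite_possibilistic_kripke M"
  shows "Po_path (start_at M s) ` (E \<inter> Paths_from M s) \<subseteq> poss_values M"
  using path_inf_in_poss_values[OF assms] Po_path_start_at[OF assms]
  by (auto simp: Paths_from_def)

lemma Po_sat_nonneg:
  assumes M: "finite_possibilistic_kripke M"
  shows "0 \<le> Po_sat M s E"
  unfolding Po_sat_def Po_def
  using Po_path_start_at_values[OF M, of s E] poss_values_range[OF M] finite_poss_values[OF M]
  by (intro psup_nonneg) (auto intro: finite_subset)

text \<open>Attainment again reduces the supremum to a single path, leaving a statement about
  infinite walks in the threshold digraph.\<close>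

lemma le_Po_sat_iff:
  assumes M: "finite_possibilistic_kripke M" and "0 < r"
  shows "r \<le> Po_sat M s (always_eventually M B) \<longleftrightarrow>
    (\<exists>\<pi>. \<pi> 0 = s \<and> (\<forall>i. (\<pi> i, \<pi> (Suc i)) \<in> poss_cut M r) \<and> (\<exists>\<^sub>\<infinity>i. \<pi> i \<in> B))"
proof -
  have "r \<le> Po_sat M s (always_eventually M B) \<longleftrightarrow>
      (\<exists>\<pi>\<in>always_eventually M B \<inter> Paths_from M s. r \<le> Po_path (start_at M s) \<pi>)"
    unfolding Po_sat_def Po_def
    using finite_subset[OF Po_path_start_at_values[OF M] finite_poss_values[OF M]] \<open>0 < r\<close>
    by (subst le_psup_iff) auto
  also have "\<dots> \<longleftrightarrow> (\<exists>\<pi>\<in>always_eventually M B \<inter> Paths_from M s.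
      \<forall>i. (\<pi> i, \<pi> (Suc i)) \<in> poss_cut M r)"
    using le_Po_path_start_at_iff[OF M] by auto
  also have "\<dots> \<longleftrightarrow>
      (\<exists>\<pi>. \<pi> 0 = s \<and> (\<forall>i. (\<pi> i, \<pi> (Suc i)) \<in> poss_cut M r) \<and> (\<exists>\<^sub>\<infinity>i. \<pi> i \<in> B))"
  proof -
    \<comment> \<open>Positivity of \<open>r\<close> turns the bound on each step into the strict
      positivity required of paths.\<close>
    have "\<pi> \<in> Paths M" if "\<forall>i. (\<pi> i, \<pi> (Suc i)) \<in> poss_cut M r" for \<pi>
      using that \<open>0 < r\<close> by (fastforce simp: Paths_def poss_cut_def intro: less_le_trans)
    then show ?thesis
      unfolding always_eventually_def Paths_from_def by blast
  qed
  finally show ?thesis .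
qed

theorem theorem16:
  fixes M :: "('s, 'ap) pks" and B :: "'s set" and s :: 's
  assumes "finite_possibilistic_kripke M"
    and "B \<subseteq> states M"
    and "s \<in> states M"
  shows "Po_sat M s (always_eventually M B)
           = psup ((\<lambda>a. min (poss_plus M s a) (poss_plus M a a)) ` B)"
proof (rule eq_by_positive_thresholds)
  note M = assms(1)
  have B: "finite B"
    using assms(1,2) by (auto simp: finite_possibilistic_kripke_def intro: finite_subset)
  show "0 \<le> Po_sat M s (always_eventually M B)"
    by (rule Po_sat_nonneg[OF M])
  show "0 \<le> psup ((\<lambda>a. min (poss_plus M s a) (poss_plus M a a)) ` B)"
    using B poss_plus_nonneg[OF M] assms(2,3) by (intro psup_nonneg) auto
  fix r :: real assume r: "0 < r"
  have "r \<le> Po_sat M s (always_eventually M B) \<longleftrightarrow>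
      (\<exists>a\<in>B. (s, a) \<in> (poss_cut M r)\<^sup>+ \<and> (a, a) \<in> (poss_cut M r)\<^sup>+)"
    unfolding le_Po_sat_iff[OF M r] by (rule infinitely_often_iff_lasso[OF B])
  also have "\<dots> \<longleftrightarrow> (\<exists>a\<in>B. r \<le> poss_plus M s a \<and> r \<le> poss_plus M a a)"
    using le_poss_plus_iff[OF M _ _ r] assms(2,3) by (intro bex_cong) auto
  also have "\<dots> \<longleftrightarrow> r \<le> psup ((\<lambda>a. min (poss_plus M s a) (poss_plus M a a)) ` B)"
    using B r by (subst le_psup_iff) auto
  finally show "r \<le> Po_sat M s (always_eventually M B) \<longleftrightarrow>
      r \<le> psup ((\<lambda>a. min (poss_plus M s a) (poss_plus M a a)) ` B)" .
qed

end
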